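(* Let $\pi$ be a commutative semigroup and let $(\{A_\varphi\}_{\varphi\in\pi},\{\mu_{p,q}\}_{p,q\in\pi},\{[,]_{p,q}\}_{p,q\in\pi},\{R_\varphi\}_{\varphi\in\pi})$ be a Rota-Baxter Poisson T-algebra of weight $0$. Define $$a\star_{p,q}b:=R_p(a)\cdot_{p,q}b,\qquad a\ast_{p,q}b:=[R_p(a),b]_{p,q}$$ for $a\in A_p$, $b\in A_q$ and $p,q\in\pi$. Then $(\{A_\varphi\}_{\varphi\in\pi},\{\star_{p,q}\}_{p,q\in\pi},\{\ast_{p,q}\}_{p,q\in\pi})$ is a pre-Poisson T-algebra.
   Context: $K$ is a field; all vector spaces, tensor products and linear maps are over $K$. Let $\pi$ be a commutative semigroup; all identities below are required for all $p,q,t\in\pi$, $a\in A_p,b\in A_q,c\in A_t$, and each operation indexed by $(p,q)$ is a linear map $A_p\otimes A_q\to A_{pq}$ on a family of vector spaces $\{A_\varphi\}_{\varphi\in\pi}$. T-algebra: linear maps $\mu_{p,q}$, written $\mu_{p,q}(a\otimes b)=a\cdot_{p,q}b$, with $(a\cdot_{p,q}b)\cdot_{pq,t}c=a\cdot_{p,qt}(b\cdot_{q,t}c)$. It is commutative if $a\cdot_{p,q}b=b\cdot_{q,p}a$. Lie T-algebra: operations $[,]_{p,q}$ with $[a,b]_{p,q}+[b,a]_{q,p}=0$ and $[[a,b]_{p,q},c]_{pq,t}+[[b,c]_{q,t},a]_{qt,p}+[[c,a]_{t,p},b]_{tp,q}=0$. Poisson T-algebra: a triple $(\{A_\varphi\},\{\mu_{p,q}\},\{[,]_{p,q}\})$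 where $(\{A_\varphi\},\{\mu_{p,q}\})$ is a commutative T-algebra, $(\{A_\varphi\},\{[,]_{p,q}\})$ is a Lie T-algebra, and $[a,b\cdot_{q,t}c]_{p,qt}=[a,b]_{p,q}\cdot_{pq,t}c+b\cdot_{q,pt}[a,c]_{p,t}$. Rota-Baxter Poisson T-algebra of weight $\lambda\in K$: a Poisson T-algebra with linear maps $\{R_\varphi:A_\varphi\to A_\varphi\}_{\varphi\in\pi}$ such that $R_p(a)\cdot_{p,q}R_q(b)=R_{pq}(R_p(a)\cdot_{p,q}b+a\cdot_{p,q}R_q(b)+\lambda\,a\cdot_{p,q}b)$ and $[R_p(a),R_q(b)]_{p,q}=R_{pq}([a,R_q(b)]_{p,q})+R_{pq}([R_p(a),b]_{p,q})+\lambda R_{pq}([a,b]_{p,q})$. Zinbiel T-algebra: operations $\star_{p,q}$ with $a\star_{p,qt}(b\star_{q,t}c)=(a\star_{p,q}b)\star_{pq,t}c+(b\star_{q,p}a)\star_{qp,t}c$. Pre-Lie T-algebra: operations $\ast_{p,q}$ with $a\ast_{p,qt}(b\ast_{q,t}c)-(a\ast_{p,q}b)\ast_{pq,t}c=b\ast_{q,pt}(a\ast_{p,t}c)-(b\ast_{q,p}a)\ast_{qp,t}c$. Pre-Poisson T-algebra: a triple $(\{A_\varphi\},\{\star_{p,q}\},\{\ast_{p,q}\})$ where $(\{A_\varphi\},\{\star_{p,q}\})$ is a Zinbiel T-algebra, $(\{A_\varphi\},\{\ast_{p,q}\})$ is a pre-Lie T-algebra, and $(a\ast_{p,q}b)\star_{pq,t}c-(b\ast_{q,p}a)\star_{qp,t}c=a\ast_{p,qt}(b\star_{q,t}c)-b\star_{q,pt}(a\ast_{p,t}c)$,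 $(a\star_{p,q}b)\ast_{pq,t}c+(b\star_{q,p}a)\ast_{qp,t}c=a\star_{p,qt}(b\ast_{q,t}c)+b\star_{q,pt}(a\ast_{p,t}c)$. *)

theory Defs
  imports "HOL-Algebra.Module"
begin

text \<open>
  The commutative semigroup is a type of class \<open>ab_semigroup_mult\<close>.  A family of vector spaces
  over the field \<open>K\<close> is a function \<open>A\<close> from that type to modules over \<open>K\<close>: each \<open>A p\<close> has its own
  carrier, addition and scalar multiplication.  The fields \<open>mult\<close> and \<open>one\<close> of the record \<open>A p\<close>
  (inherited from the library's record of rings) play no role.

  An equation between elements of, say, \<open>A (p * (q * t))\<close> and \<open>A (q * (p * t))\<close> makes sense because
  both indices are the same element of the semigroup; the sums in it are always formed
  in \<open>A (p * q * t)\<close>.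
\<close>

definition linear_on ::
  "('k, 'm) ring_scheme \<Rightarrow> ('k, 'v, 'n) module_scheme \<Rightarrow> ('k, 'w, 'l) module_scheme
    \<Rightarrow> ('v \<Rightarrow> 'w) \<Rightarrow> bool"
  where "linear_on K M N f \<longleftrightarrow>
    f \<in> carrier M \<rightarrow> carrier N \<and>
    (\<forall>x\<in>carrier M. \<forall>y\<in>carrier M. f (x \<oplus>\<^bsub>M\<^esub> y) = f x \<oplus>\<^bsub>N\<^esub> f y) \<and>
    (\<forall>r\<in>carrier K. \<forall>x\<in>carrier M. f (r \<odot>\<^bsub>M\<^esub> x) = r \<odot>\<^bsub>N\<^esub> f x)"

text \<open>A linear map from the tensor product of \<open>L\<close> and \<open>M\<close> to \<open>N\<close> is given as the bilinear map
  that corresponds to it under the universal property.\<close>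

definition bilinear_on ::
  "('k, 'm) ring_scheme \<Rightarrow> ('k, 'u, 'o) module_scheme \<Rightarrow> ('k, 'v, 'n) module_scheme
    \<Rightarrow> ('k, 'w, 'l) module_scheme \<Rightarrow> ('u \<Rightarrow> 'v \<Rightarrow> 'w) \<Rightarrow> bool"
  where "bilinear_on K L M N f \<longleftrightarrow>
    (\<forall>a\<in>carrier L. linear_on K M N (\<lambda>b. f a b)) \<and>
    (\<forall>b\<in>carrier M. linear_on K L N (\<lambda>a. f a b))"

locale vector_space_family =
  fixes K :: "('k, 'm) ring_scheme"
    and A :: "'p::ab_semigroup_mult \<Rightarrow> ('k, 'v, 'n) module_scheme"
  assumes field_K: "field K"
    and module_A: "module K (A p)"

locale T_operation = vector_space_family K A
  for K :: "('k, 'm) ring_scheme"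
    and A :: "'p::ab_semigroup_mult \<Rightarrow> ('k, 'v, 'n) module_scheme" +
  fixes f :: "'p \<Rightarrow> 'p \<Rightarrow> 'v \<Rightarrow> 'v \<Rightarrow> 'v"
  assumes bilinear: "bilinear_on K (A p) (A q) (A (p * q)) (f p q)"

locale T_algebra = T_operation K A mu
  for K :: "('k, 'm) ring_scheme"
    and A :: "'p::ab_semigroup_mult \<Rightarrow> ('k, 'v, 'n) module_scheme"
    and mu :: "'p \<Rightarrow> 'p \<Rightarrow> 'v \<Rightarrow> 'v \<Rightarrow> 'v" +
  assumes assoc:
    "\<lbrakk>a \<in> carrier (A p); b \<in> carrier (A q); c \<in> carrier (A t)\<rbrakk> \<Longrightarrow>
      mu (p * q) t (mu p q a b) c = mu p (q * t) a (mu q t b c)"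

locale commutative_T_algebra = T_algebra K A mu
  for K :: "('k, 'm) ring_scheme"
    and A :: "'p::ab_semigroup_mult \<Rightarrow> ('k, 'v, 'n) module_scheme"
    and mu :: "'p \<Rightarrow> 'p \<Rightarrow> 'v \<Rightarrow> 'v \<Rightarrow> 'v" +
  assumes comm:
    "\<lbrakk>a \<in> carrier (A p); b \<in> carrier (A q)\<rbrakk> \<Longrightarrow> mu p q a b = mu q p b a"

locale Lie_T_algebra = T_operation K A br
  for K :: "('k, 'm) ring_scheme"
    and A :: "'p::ab_semigroup_mult \<Rightarrow> ('k, 'v, 'n) module_scheme"
    and br :: "'p \<Rightarrow> 'p \<Rightarrow> 'v \<Rightarrow> 'v \<Rightarrow> 'v" +
  assumes skew:
    "\<lbrakk>a \<in> carrier (A p); b \<in> carrier (A q)\<rbrakk> \<Longrightarrow>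
      br p q a b \<oplus>\<^bsub>A (p * q)\<^esub> br q p b a = \<zero>\<^bsub>A (p * q)\<^esub>"
  and Jacobi:
    "\<lbrakk>a \<in> carrier (A p); b \<in> carrier (A q); c \<in> carrier (A t)\<rbrakk> \<Longrightarrow>
      br (p * q) t (br p q a b) c \<oplus>\<^bsub>A (p * q * t)\<^esub> br (q * t) p (br q t b c) a
        \<oplus>\<^bsub>A (p * q * t)\<^esub> br (t * p) q (br t p c a) b = \<zero>\<^bsub>A (p * q * t)\<^esub>"

locale Poisson_T_algebra = commutative_T_algebra K A mu + Lie_T_algebra K A br
  for K :: "('k, 'm) ring_scheme"
    and A :: "'p::ab_semigroup_mult \<Rightarrow> ('k, 'v, 'n) module_scheme"
    and mu br :: "'p \<Rightarrow> 'p \<Rightarrow> 'v \<Rightarrow> 'v \<Rightarrow> 'v" +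
  assumes Leibniz:
    "\<lbrakk>a \<in> carrier (A p); b \<in> carrier (A q); c \<in> carrier (A t)\<rbrakk> \<Longrightarrow>
      br p (q * t) a (mu q t b c) =
        mu (p * q) t (br p q a b) c \<oplus>\<^bsub>A (p * q * t)\<^esub> mu q (p * t) b (br p t a c)"

locale Rota_Baxter_Poisson_T_algebra = Poisson_T_algebra K A mu br
  for K :: "('k, 'm) ring_scheme"
    and A :: "'p::ab_semigroup_mult \<Rightarrow> ('k, 'v, 'n) module_scheme"
    and mu br :: "'p \<Rightarrow> 'p \<Rightarrow> 'v \<Rightarrow> 'v \<Rightarrow> 'v" +
  fixes R :: "'p \<Rightarrow> 'v \<Rightarrow> 'v"
    and wt :: 'k
  assumes weight_closed: "wt \<in> carrier K"
    and linear_R: "linear_on K (A p) (A p) (R p)"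
    and Rota_Baxter_mu:
    "\<lbrakk>a \<in> carrier (A p); b \<in> carrier (A q)\<rbrakk> \<Longrightarrow>
      mu p q (R p a) (R q b) =
        R (p * q) (mu p q (R p a) b \<oplus>\<^bsub>A (p * q)\<^esub> mu p q a (R q b)
          \<oplus>\<^bsub>A (p * q)\<^esub> wt \<odot>\<^bsub>A (p * q)\<^esub> mu p q a b)"
    and Rota_Baxter_br:
    "\<lbrakk>a \<in> carrier (A p); b \<in> carrier (A q)\<rbrakk> \<Longrightarrow>
      br p q (R p a) (R q b) =
        R (p * q) (br p q a (R q b)) \<oplus>\<^bsub>A (p * q)\<^esub> R (p * q) (br p q (R p a) b)
          \<oplus>\<^bsub>A (p * q)\<^esub> wt \<odot>\<^bsub>A (p * q)\<^esub> R (p * q) (br p q a b)"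

locale Zinbiel_T_algebra = T_operation K A zi
  for K :: "('k, 'm) ring_scheme"
    and A :: "'p::ab_semigroup_mult \<Rightarrow> ('k, 'v, 'n) module_scheme"
    and zi :: "'p \<Rightarrow> 'p \<Rightarrow> 'v \<Rightarrow> 'v \<Rightarrow> 'v" +
  assumes Zinbiel:
    "\<lbrakk>a \<in> carrier (A p); b \<in> carrier (A q); c \<in> carrier (A t)\<rbrakk> \<Longrightarrow>
      zi p (q * t) a (zi q t b c) =
        zi (p * q) t (zi p q a b) c \<oplus>\<^bsub>A (p * q * t)\<^esub> zi (q * p) t (zi q p b a) c"

locale pre_Lie_T_algebra = T_operation K A pl
  for K :: "('k, 'm) ring_scheme"
    and A :: "'p::ab_semigroup_mult \<Rightarrow> ('k, 'v, 'n) module_scheme"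
    and pl :: "'p \<Rightarrow> 'p \<Rightarrow> 'v \<Rightarrow> 'v \<Rightarrow> 'v" +
  assumes pre_Lie:
    "\<lbrakk>a \<in> carrier (A p); b \<in> carrier (A q); c \<in> carrier (A t)\<rbrakk> \<Longrightarrow>
      pl p (q * t) a (pl q t b c) \<ominus>\<^bsub>A (p * q * t)\<^esub> pl (p * q) t (pl p q a b) c =
        pl q (p * t) b (pl p t a c) \<ominus>\<^bsub>A (p * q * t)\<^esub> pl (q * p) t (pl q p b a) c"

locale pre_Poisson_T_algebra = Zinbiel_T_algebra K A zi + pre_Lie_T_algebra K A pl
  for K :: "('k, 'm) ring_scheme"
    and A :: "'p::ab_semigroup_mult \<Rightarrow> ('k, 'v, 'n) module_scheme"
    and zi pl :: "'p \<Rightarrow> 'p \<Rightarrow> 'v \<Rightarrow> 'v \<Rightarrow> 'v" +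
  assumes pre_Poisson_1:
    "\<lbrakk>a \<in> carrier (A p); b \<in> carrier (A q); c \<in> carrier (A t)\<rbrakk> \<Longrightarrow>
      zi (p * q) t (pl p q a b) c \<ominus>\<^bsub>A (p * q * t)\<^esub> zi (q * p) t (pl q p b a) c =
        pl p (q * t) a (zi q t b c) \<ominus>\<^bsub>A (p * q * t)\<^esub> zi q (p * t) b (pl p t a c)"
  and pre_Poisson_2:
    "\<lbrakk>a \<in> carrier (A p); b \<in> carrier (A q); c \<in> carrier (A t)\<rbrakk> \<Longrightarrow>
      pl (p * q) t (zi p q a b) c \<oplus>\<^bsub>A (p * q * t)\<^esub> pl (q * p) t (zi q p b a) c =
        zi p (q * t) a (pl q t b c) \<oplus>\<^bsub>A (p * q * t)\<^esub> zi q (p * t) b (pl p t a c)"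

end

theory Submission
  imports Defs
begin

text \<open>
  For weight zero the two Rota-Baxter identities say that \<open>R\<close> maps \<open>a \<star> b + b \<star> a\<close> to
  \<open>R a \<cdot> R b\<close> and \<open>a \<ast> b - b \<ast> a\<close> to \<open>[R a, R b]\<close>.  Writing \<open>x = R a\<close> and \<open>y = R b\<close>, the
  pre-Poisson identities become identities of the Poisson T-algebra in \<open>x\<close>, \<open>y\<close> and \<open>c\<close>:
  associativity, Jacobi and the Leibniz rule in each of the two arguments of the bracket.
\<close>

lemma linear_on_closed: "linear_on K M N f \<Longrightarrow> x \<in> carrier M \<Longrightarrow> f x \<in> carrier N"
  by (auto simp: linear_on_def)

lemma linear_on_add:
  "\<lbrakk>linear_on K M N f; x \<in> carrier M; y \<in> carrier M\<rbrakk> \<Longrightarrow>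
    f (x \<oplus>\<^bsub>M\<^esub> y) = f x \<oplus>\<^bsub>N\<^esub> f y"
  by (auto simp: linear_on_def)

lemma linear_on_compose:
  assumes "linear_on K L M f" and "linear_on K M N g"
  shows "linear_on K L N (\<lambda>x. g (f x))"
  using assms unfolding linear_on_def by (auto simp: Pi_iff)

lemma linear_on_minus:
  assumes "linear_on K M N f" and "abelian_group M" and "abelian_group N" and x: "x \<in> carrier M"
  shows "f (\<ominus>\<^bsub>M\<^esub> x) = \<ominus>\<^bsub>N\<^esub> f x"
proof -
  interpret M: abelian_group M by fact
  interpret N: abelian_group N by fact
  note closed = linear_on_closed[OF assms(1)] and add = linear_on_add[OF assms(1)]
  \<comment> \<open>\<open>linear_on\<close> asks only for additivity and homogeneity. That zero
    goes to zero follows by cancellation, since the image of zero equals its own double.\<close>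
  have "f \<zero>\<^bsub>M\<^esub> \<oplus>\<^bsub>N\<^esub> f \<zero>\<^bsub>M\<^esub> = f \<zero>\<^bsub>M\<^esub>"
    using add[of "\<zero>\<^bsub>M\<^esub>" "\<zero>\<^bsub>M\<^esub>"] by simp
  then have "f \<zero>\<^bsub>M\<^esub> = \<zero>\<^bsub>N\<^esub>"
    by (simp add: closed)
  then have "f (\<ominus>\<^bsub>M\<^esub> x) \<oplus>\<^bsub>N\<^esub> f x = \<zero>\<^bsub>N\<^esub>"
    using x by (simp flip: add add: M.l_neg)
  then show ?thesis
    using x by (intro N.minus_equality[symmetric]) (auto intro: closed)
qed

context abelian_group
begin

lemma minus_eq_iff_eq_add:
  assumes "x \<in> carrier G" "y \<in> carrier G" "z \<in> carrier G"
  shows "x \<ominus> y = z \<longleftrightarrow> x = z \<oplus> y"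
  using assms by (auto simp: minus_eq a_assoc l_neg r_neg)

text \<open>Passes from the derivation form of an identity, where \<open>u \<ominus> v\<close> is
  the image of a commutator, to the shape of the pre-Lie identity.\<close>

lemma minus_eq_minus_if:
  assumes "x \<in> carrier G" "x' \<in> carrier G" "u \<in> carrier G" "v \<in> carrier G"
    and "x = x' \<oplus> (u \<ominus> v)"
  shows "x \<ominus> u = x' \<ominus> v"
proof -
  have "u \<oplus> (x' \<oplus> (\<ominus> u \<oplus> \<ominus> v)) = u \<oplus> \<ominus> u \<oplus> (x' \<oplus> \<ominus> v)"
    using assms by (simp add: a_ac)
  then show ?thesis
    using assms by (simp add: minus_eq a_ac r_neg)
qed

end

context T_operation
begin

lemma group_A: "abelian_group (A p)"
  using module_A[of p] by (rule module.axioms(2))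

lemma linear_left: "b \<in> carrier (A q) \<Longrightarrow> linear_on K (A p) (A (p * q)) (\<lambda>a. f p q a b)"
  and linear_right: "a \<in> carrier (A p) \<Longrightarrow> linear_on K (A q) (A (p * q)) (f p q a)"
  using bilinear[of p q] by (auto simp: bilinear_on_def)

lemma closed:
  "a \<in> carrier (A p) \<Longrightarrow> b \<in> carrier (A q) \<Longrightarrow> f p q a b \<in> carrier (A (p * q))"
  using linear_right[of a p q] by (auto simp: linear_on_def)

lemma add_left:
  "\<lbrakk>a \<in> carrier (A p); a' \<in> carrier (A p); b \<in> carrier (A q)\<rbrakk> \<Longrightarrow>
    f p q (a \<oplus>\<^bsub>A p\<^esub> a') b = f p q a b \<oplus>\<^bsub>A (p * q)\<^esub> f p q a' b"
  using linear_left[of b q p] by (auto simp: linear_on_def)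

lemma uminus_left:
  "\<lbrakk>a \<in> carrier (A p); b \<in> carrier (A q)\<rbrakk> \<Longrightarrow>
    f p q (\<ominus>\<^bsub>A p\<^esub> a) b = \<ominus>\<^bsub>A (p * q)\<^esub> f p q a b"
  using linear_on_minus[OF linear_left group_A group_A] .

lemma uminus_right:
  "\<lbrakk>a \<in> carrier (A p); b \<in> carrier (A q)\<rbrakk> \<Longrightarrow>
    f p q a (\<ominus>\<^bsub>A q\<^esub> b) = \<ominus>\<^bsub>A (p * q)\<^esub> f p q a b"
  using linear_on_minus[OF linear_right group_A group_A] .

lemma minus_left:
  assumes "a \<in> carrier (A p)" "a' \<in> carrier (A p)" "b \<in> carrier (A q)"
  shows "f p q (a \<ominus>\<^bsub>A p\<^esub> a') b = f p q a b \<ominus>\<^bsub>A (p * q)\<^esub> f p q a' b"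
  using assms
  by (simp add: abelian_group.minus_eq[OF group_A] add_left uminus_left
      abelian_group.a_inv_closed[OF group_A])

text \<open>With \<open>g = R\<close> this makes both new operations bilinear: \<open>g\<close>
  preserves each degree, so it only composes a linear map into the first slot.\<close>

lemma T_operation_precompose:
  assumes g: "\<And>p. linear_on K (A p) (A p) (g p)"
  shows "T_operation K A (\<lambda>p q a b. f p q (g p a) b)"
proof unfold_locales
  fix p q
  show "bilinear_on K (A p) (A q) (A (p * q)) (\<lambda>a b. f p q (g p a) b)"
    unfolding bilinear_on_def
    using linear_right[OF linear_on_closed[OF g]] linear_on_compose[OF g linear_left] by blast
qed

end

lemma (in Lie_T_algebra) skew_minus:
  assumes "a \<in> carrier (A p)" "b \<in> carrier (A q)"
  shows "br p q a b = \<ominus>\<^bsub>A (p * q)\<^esub> br q p b a"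
  using assms skew[of a p b q] closed[of b q a p] closed[of a p b q]
    abelian_group.minus_equality[OF group_A, of "p * q" "br p q a b" "br q p b a"]
  by (simp add: mult.commute)

text \<open>The Jacobi identity, rearranged by skew-symmetry so that bracketing with
  \<open>a\<close> is a derivation. Unlike the cyclic form, it keeps \<open>c\<close> in the last
  slot of every term, as the pre-Lie identity does.\<close>

lemma (in Lie_T_algebra) Jacobi_derivation:
  assumes a: "a \<in> carrier (A p)" and b: "b \<in> carrier (A q)" and c: "c \<in> carrier (A t)"
  shows "br p (q * t) a (br q t b c) =
    br q (p * t) b (br p t a c) \<oplus>\<^bsub>A (p * q * t)\<^esub> br (p * q) t (br p q a b) c"
proof -
  interpret G: abelian_group "A (p * q * t)" by (rule group_A)
  have abc: "br (p * q) t (br p q a b) c \<in> carrier (A (p * q * t))"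
    using closed[OF closed[OF a b] c] .
  have bac: "br q (p * t) b (br p t a c) \<in> carrier (A (p * q * t))"
    using closed[OF b closed[OF a c]] by (simp add: mult.assoc mult.left_commute)
  have acb: "br p (q * t) a (br q t b c) \<in> carrier (A (p * q * t))"
    using closed[OF a closed[OF b c]] by (simp add: mult.assoc)
  have "br (q * t) p (br q t b c) a = \<ominus>\<^bsub>A (p * q * t)\<^esub> br p (q * t) a (br q t b c)"
    using skew_minus[OF closed[OF b c] a] by (simp add: mult.assoc mult.commute mult.left_commute)
  \<comment> \<open>Both the outer and the inner bracket are reversed, so the two signs
    cancel.\<close>
  moreover have "br (t * p) q (br t p c a) b = br q (p * t) b (br p t a c)"
  proof -
    have "br (t * p) q (br t p c a) b =
        \<ominus>\<^bsub>A (p * q * t)\<^esub> br q (p * t) b (\<ominus>\<^bsub>A (p * t)\<^esub> br p t a c)"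
      using skew_minus[OF closed[OF c a] b] skew_minus[OF c a]
      by (simp add: mult.assoc mult.commute mult.left_commute)
    also have "\<dots> = br q (p * t) b (br p t a c)"
      using uminus_right[OF b closed[OF a c]] G.minus_minus[OF bac]
      by (simp add: mult.assoc mult.commute mult.left_commute)
    finally show ?thesis .
  qed
  ultimately have "br (p * q) t (br p q a b) c
      \<oplus>\<^bsub>A (p * q * t)\<^esub> \<ominus>\<^bsub>A (p * q * t)\<^esub> br p (q * t) a (br q t b c)
      \<oplus>\<^bsub>A (p * q * t)\<^esub> br q (p * t) b (br p t a c) = \<zero>\<^bsub>A (p * q * t)\<^esub>"
    using Jacobi[OF a b c] by simp
  then have "br q (p * t) b (br p t a c) \<oplus>\<^bsub>A (p * q * t)\<^esub> br (p * q) t (br p q a b) c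
      \<ominus>\<^bsub>A (p * q * t)\<^esub> br p (q * t) a (br q t b c) = \<zero>\<^bsub>A (p * q * t)\<^esub>"
    using abc bac acb by (simp add: G.minus_eq G.a_ac)
  then show ?thesis
    using abc bac acb by (simp add: G.minus_eq_iff_eq_add)
qed

text \<open>Reverse the bracket, expand the bracket of \<open>c\<close> with the product by
  \<open>Leibniz\<close>, and reverse the two inner brackets: the signs cancel. Commutativity then
  moves \<open>b\<close> to the front of its term.\<close>

lemma Poisson_Leibniz_left:
  assumes "Poisson_T_algebra K A mu br"
    and a: "a \<in> carrier (A p)" and b: "b \<in> carrier (A q)" and c: "c \<in> carrier (A t)"
  shows "br (p * q) t (mu p q a b) c =
    mu p (q * t) a (br q t b c) \<oplus>\<^bsub>A (p * q * t)\<^esub> mu q (p * t) b (br p t a c)"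
proof -
  \<comment> \<open>Product and bracket both inherit the facts of \<open>T_operation\<close>;
    separate prefixes keep the two copies apart.\<close>
  interpret mu: commutative_T_algebra K A mu
    by (rule Poisson_T_algebra.axioms(1)[OF assms(1)])
  interpret br: Lie_T_algebra K A br
    by (rule Poisson_T_algebra.axioms(2)[OF assms(1)])
  interpret Poisson_T_algebra K A mu br by fact
  interpret G: abelian_group "A (p * q * t)" by (rule br.group_A)
  have bac: "mu (p * t) q (br p t a c) b \<in> carrier (A (p * q * t))"
    using mu.closed[OF br.closed[OF a c] b] by (simp add: mult.assoc mult.commute mult.left_commute)
  have abc: "mu p (q * t) a (br q t b c) \<in> carrier (A (p * q * t))"
    using mu.closed[OF a br.closed[OF b c]] by (simp add: mult.assoc)
  have "br (p * q) t (mu p q a b) c =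
      \<ominus>\<^bsub>A (p * q * t)\<^esub> (mu (t * p) q (br t p c a) b
        \<oplus>\<^bsub>A (p * q * t)\<^esub> mu p (q * t) a (br t q c b))"
    using br.skew_minus[OF mu.closed[OF a b] c] Leibniz[OF c a b]
    by (simp add: mult.assoc mult.commute mult.left_commute)
  also have "mu (t * p) q (br t p c a) b =
      \<ominus>\<^bsub>A (p * q * t)\<^esub> mu (p * t) q (br p t a c) b"
    using mu.uminus_left[OF br.closed[OF a c] b] br.skew_minus[OF c a]
    by (simp add: mult.assoc mult.commute mult.left_commute)
  also have "mu p (q * t) a (br t q c b) =
      \<ominus>\<^bsub>A (p * q * t)\<^esub> mu p (q * t) a (br q t b c)"
    using mu.uminus_right[OF a br.closed[OF b c]] br.skew_minus[OF c b]
    by (simp add: mult.assoc mult.commute mult.left_commute)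
  finally show ?thesis
    using bac abc mu.comm[OF br.closed[OF a c] b] by (simp add: G.minus_add G.a_comm)
qed

text \<open>Each Rota-Baxter identity has a term with \<open>R\<close> on the second factor.
  Commutativity or skew-symmetry moves that factor to the front, so that only the new operations
  appear under the outer \<open>R\<close>; skew-symmetry is the source of the minus sign in the
  second identity.\<close>

lemma weight_zero_Rota_Baxter:
  assumes "Rota_Baxter_Poisson_T_algebra K A mu br R \<zero>\<^bsub>K\<^esub>"
    and a: "a \<in> carrier (A p)" and b: "b \<in> carrier (A q)"
  shows Rota_Baxter_mu_zero: "mu p q (R p a) (R q b) =
      R (p * q) (mu p q (R p a) b \<oplus>\<^bsub>A (p * q)\<^esub> mu q p (R q b) a)" (is ?mu)
    and Rota_Baxter_br_zero: "br p q (R p a) (R q b) =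
      R (p * q) (br p q (R p a) b) \<ominus>\<^bsub>A (p * q)\<^esub> R (p * q) (br q p (R q b) a)" (is ?br)
proof -
  note Poisson = Rota_Baxter_Poisson_T_algebra.axioms(1)[OF assms(1)]
  interpret mu: commutative_T_algebra K A mu
    by (rule Poisson_T_algebra.axioms(1)[OF Poisson])
  interpret br: Lie_T_algebra K A br
    by (rule Poisson_T_algebra.axioms(2)[OF Poisson])
  interpret Rota_Baxter_Poisson_T_algebra K A mu br R "\<zero>\<^bsub>K\<^esub>" by fact
  \<comment> \<open>The scalar action is needed here: multiplication by the zero scalar removes the
    weight term.\<close>
  interpret G: module K "A (p * q)" by (rule mu.module_A)
  note R_closed = linear_on_closed[OF linear_R]
  have ab: "mu p q (R p a) b \<in> carrier (A (p * q))" "mu p q a (R q b) \<in> carrier (A (p * q))"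
    "mu p q a b \<in> carrier (A (p * q))"
    "br p q (R p a) b \<in> carrier (A (p * q))" "br p q a (R q b) \<in> carrier (A (p * q))"
    "br p q a b \<in> carrier (A (p * q))"
    using mu.closed br.closed R_closed a b by auto
  have ba: "br q p (R q b) a \<in> carrier (A (p * q))"
    using br.closed[OF R_closed[OF b] a] by (simp add: mult.commute)
  show ?mu
    using Rota_Baxter_mu[OF a b] ab mu.comm[OF a R_closed[OF b]] by simp
  have "R (p * q) (br p q a (R q b)) = \<ominus>\<^bsub>A (p * q)\<^esub> R (p * q) (br q p (R q b) a)"
    using br.skew_minus[OF a R_closed[OF b]]
      linear_on_minus[OF linear_R br.group_A br.group_A ba] by simp
  then show ?br
    using Rota_Baxter_br[OF a b] ab ba R_closed by (simp add: G.minus_eq G.a_comm)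
qed

theorem proposition4p25:
  fixes K :: "('k, 'm) ring_scheme"
    and A :: "'p::ab_semigroup_mult \<Rightarrow> ('k, 'v, 'n) module_scheme"
    and mu br :: "'p \<Rightarrow> 'p \<Rightarrow> 'v \<Rightarrow> 'v \<Rightarrow> 'v"
    and R :: "'p \<Rightarrow> 'v \<Rightarrow> 'v"
  assumes "Rota_Baxter_Poisson_T_algebra K A mu br R \<zero>\<^bsub>K\<^esub>"
  shows "pre_Poisson_T_algebra K A
    (\<lambda>p q a b. mu p q (R p a) b)
    (\<lambda>p q a b. br p q (R p a) b)"
proof -
  note Poisson = Rota_Baxter_Poisson_T_algebra.axioms(1)[OF assms(1)]
  interpret mu: commutative_T_algebra K A mu
    by (rule Poisson_T_algebra.axioms(1)[OF Poisson])
  interpret br: Lie_T_algebra K A br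
    by (rule Poisson_T_algebra.axioms(2)[OF Poisson])
  interpret Rota_Baxter_Poisson_T_algebra K A mu br R "\<zero>\<^bsub>K\<^esub>" by fact
  note R_closed = linear_on_closed[OF linear_R]
  let ?zi = "\<lambda>p q a b. mu p q (R p a) b" and ?pl = "\<lambda>p q a b. br p q (R p a) b"
  \<comment> \<open>This settles bilinearity of both operations, which leaves the four identities to
    prove.\<close>
  interpret zi: T_operation K A ?zi by (rule mu.T_operation_precompose[OF linear_R])
  interpret pl: T_operation K A ?pl by (rule br.T_operation_precompose[OF linear_R])
  show ?thesis
  proof unfold_locales
    fix a b c p q t
    assume a: "a \<in> carrier (A p)" and b: "b \<in> carrier (A q)" and c: "c \<in> carrier (A t)"
    note Ra = R_closed[OF a] and Rb = R_closed[OF b]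
    interpret G: abelian_group "A (p * q * t)" by (rule br.group_A)
    \<comment> \<open>The element is formed in degree \<open>q * p\<close>, but it is to be added in
      \<open>A (p * q)\<close>.\<close>
    have zi_ba: "?zi q p b a \<in> carrier (A (p * q))" and pl_ba: "?pl q p b a \<in> carrier (A (p * q))"
      using zi.closed[OF b a] pl.closed[OF b a] by (simp_all add: mult.commute)
    have mu_RR: "mu p q (R p a) (R q b) =
        R (p * q) (?zi p q a b) \<oplus>\<^bsub>A (p * q)\<^esub> R (p * q) (?zi q p b a)"
      using Rota_Baxter_mu_zero[OF assms a b] linear_on_add[OF linear_R zi.closed[OF a b] zi_ba] by simp
    note br_RR = Rota_Baxter_br_zero[OF assms a b]
    note RR_closed = R_closed[OF zi.closed[OF a b]] R_closed[OF zi_ba]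
      R_closed[OF pl.closed[OF a b]] R_closed[OF pl_ba]
    \<comment> \<open>Only this instance of commutativity is used for rewriting: it identifies
      \<open>q * p\<close> with \<open>p * q\<close> and leaves indices such as
      \<open>p * (q * t)\<close> alone.\<close>
    note index = mult.commute[of q p]
    \<comment> \<open>Associativity turns the left side into the product of
      \<open>mu p q (R p a) (R q b)\<close> with \<open>c\<close>; \<open>mu_RR\<close> splits the
      first factor into the two summands.\<close>
    show "?zi p (q * t) a (?zi q t b c) =
        ?zi (p * q) t (?zi p q a b) c \<oplus>\<^bsub>A (p * q * t)\<^esub> ?zi (q * p) t (?zi q p b a) c"
      using mu.assoc[OF Ra Rb c] mu_RR mu.add_left[OF RR_closed(1,2) c] by (simp add: index)
    \<comment> \<open>By \<open>mu_RR\<close> the left side is the bracket of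
      \<open>mu p q (R p a) (R q b)\<close> with \<open>c\<close>, which the Leibniz rule in the
      first argument expands.\<close>
    show "?pl (p * q) t (?zi p q a b) c \<oplus>\<^bsub>A (p * q * t)\<^esub> ?pl (q * p) t (?zi q p b a) c =
        ?zi p (q * t) a (?pl q t b c) \<oplus>\<^bsub>A (p * q * t)\<^esub> ?zi q (p * t) b (?pl p t a c)"
      using Poisson_Leibniz_left[OF Poisson Ra Rb c] mu_RR
        br.add_left[OF RR_closed(1,2) c] by (simp add: index)
    \<comment> \<open>Acting on \<open>c\<close> with the bracket of \<open>R p a\<close> and
      \<open>R q b\<close>, by product here and by bracket in \<open>br_br\<close>, gives the
      commutator terms of the two remaining identities.\<close>
    have br_mu: "mu (p * q) t (br p q (R p a) (R q b)) c =
        ?zi (p * q) t (?pl p q a b) c \<ominus>\<^bsub>A (p * q * t)\<^esub> ?zi (q * p) t (?pl q p b a) c"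
      using br_RR mu.minus_left[OF RR_closed(3,4) c] by (simp add: index)
    have br_br: "br (p * q) t (br p q (R p a) (R q b)) c =
        ?pl (p * q) t (?pl p q a b) c \<ominus>\<^bsub>A (p * q * t)\<^esub> ?pl (q * p) t (?pl q p b a) c"
      using br_RR br.minus_left[OF RR_closed(3,4) c] by (simp add: index)
    have bac: "?zi q (p * t) b (?pl p t a c) \<in> carrier (A (p * q * t))"
      "?pl q (p * t) b (?pl p t a c) \<in> carrier (A (p * q * t))"
      using zi.closed[OF b pl.closed[OF a c]] pl.closed[OF b pl.closed[OF a c]]
      by (simp_all add: mult.assoc mult.left_commute)
    have acb: "?pl p (q * t) a (?zi q t b c) \<in> carrier (A (p * q * t))"
      "?pl p (q * t) a (?pl q t b c) \<in> carrier (A (p * q * t))"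
      using pl.closed[OF a zi.closed[OF b c]] pl.closed[OF a pl.closed[OF b c]]
      by (simp_all add: mult.assoc)
    have pl_pl: "?pl (p * q) t (?pl p q a b) c \<in> carrier (A (p * q * t))"
      "?pl (q * p) t (?pl q p b a) c \<in> carrier (A (p * q * t))"
      using pl.closed[OF pl.closed[OF a b] c] pl.closed[OF pl.closed[OF b a] c]
      by (simp_all add: index)
    \<comment> \<open>Closure permits moving one term of \<open>Leibniz\<close> across the equation,
      so that its right side becomes the left side of \<open>br_mu\<close>.\<close>
    have "mu (p * q) t (br p q (R p a) (R q b)) c \<in> carrier (A (p * q * t))"
      using mu.closed br.closed Ra Rb c by blast
    then have "?pl p (q * t) a (?zi q t b c) \<ominus>\<^bsub>A (p * q * t)\<^esub> ?zi q (p * t) b (?pl p t a c) =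
        mu (p * q) t (br p q (R p a) (R q b)) c"
      using Leibniz[OF Ra Rb c] bac acb by (simp add: G.minus_eq_iff_eq_add)
    then show "?zi (p * q) t (?pl p q a b) c \<ominus>\<^bsub>A (p * q * t)\<^esub> ?zi (q * p) t (?pl q p b a) c =
        ?pl p (q * t) a (?zi q t b c) \<ominus>\<^bsub>A (p * q * t)\<^esub> ?zi q (p * t) b (?pl p t a c)"
      using br_mu by simp
    \<comment> \<open>The pre-Lie identity is the derivation form of Jacobi for
      \<open>R p a\<close>, \<open>R q b\<close> and \<open>c\<close>, with the double bracket
      replaced by the difference in \<open>br_br\<close>.\<close>
    show "?pl p (q * t) a (?pl q t b c) \<ominus>\<^bsub>A (p * q * t)\<^esub> ?pl (p * q) t (?pl p q a b) c =
        ?pl q (p * t) b (?pl p t a c) \<ominus>\<^bsub>A (p * q * t)\<^esub> ?pl (q * p) t (?pl q p b a) c"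
      using br.Jacobi_derivation[OF Ra Rb c] br_br bac acb pl_pl
      by (intro G.minus_eq_minus_if) simp_all
  qed
qed

end
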